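(* For every integer $m>1$ and every (arbitrarily small) $\varepsilon>0$, as $n\to\infty$, $$\mathbb P(G_m^n\text{ is connected})=1-O\left(\left(\frac{(\log\log n)^{1+\varepsilon}}{\log n}\right)^{\frac{m-1}{3}}\right).$$
   Context: The Bollobás–Riordan preferential attachment multigraph $G_m^n$: $G_1^1$ is a single vertex $1$ with a loop (a loop contributes $2$ to the degree); given $G_1^{t-1}$ on $[t-1]$, vertex $t$ is added together with one edge, which joins $t$ to $s\in[t-1]$ with probability $\deg_{G_1^{t-1}}(s)/(2t-1)$ and is a loop at $t$ with probability $1/(2t-1)$. $G_m^n$ is obtained from $G_1^{mn}$ by merging vertices $m(j-1)+1,\dots,mj$ into a single vertex $j$, $j=1,\dots,n$ (keeping multiple edges and loops). Equivalently (in distribution): let $w_1,\dots,w_{mn+1}$ be independent mean-$1$ exponentials, $W_k=\sum_{i\le k}w_i$, $R_k=W_k/W_{mn+1}$, $R_0=0$; conditionally on $\{W_k\}$ let $\ell_1,\dots,\ell_{mn}$ be independent, $\ell_k$ with density $\frac1{2\sqrt{R_kx}}$ on $(0,R_k]$; vertex $j$ is the interval $(R_{m(j-1)},R_{mj}]$ and for each $k\in[mn]$ there is one edge joining the vertices containing $R_k$ and $\ell_k$. The constant in $O(\cdot)$ may depend on $m$ and $\varepsilon$. *)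

theory Defs
  imports "HOL-Probability.Probability" "HOL-Library.Uprod" "HOL-Library.Landau_Symbols"
begin

text \<open>A multigraph is a vertex set together with a multiset of unordered pairs of vertices;
  \<open>Upair v v\<close> is a loop.\<close>

type_synonym 'a multigraph = "'a set \<times> 'a uprod multiset"

abbreviation mverts :: "'a multigraph \<Rightarrow> 'a set" where
  "mverts G \<equiv> fst G"

abbreviation medges :: "'a multigraph \<Rightarrow> 'a uprod multiset" where
  "medges G \<equiv> snd G"

definition mdegree :: "'a multigraph \<Rightarrow> 'a \<Rightarrow> nat" where
  "mdegree G v =
     (\<Sum>e\<in>#medges G. if e = Upair v v then 2 else if v \<in> set_uprod e then 1 else 0)"

definition mconnected :: "'a multigraph \<Rightarrow> bool" where
  "mconnected G \<longleftrightarrow>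
     (\<forall>u\<in>mverts G. \<forall>v\<in>mverts G. (\<lambda>x y. Upair x y \<in># medges G)\<^sup>*\<^sup>* u v)"

definition merge_vertices :: "('a \<Rightarrow> 'b) \<Rightarrow> 'a multigraph \<Rightarrow> 'b multigraph" where
  "merge_vertices f G = (f ` mverts G, image_mset (map_uprod f) (medges G))"

text \<open>The other end of the edge added with the new vertex \<open>t\<close>. The weights sum to 1 only if
  \<open>G\<close> is a multigraph on \<open>{1..<t}\<close> with \<open>t - 1\<close> edges, which is always so below: see the lemmas
  \<open>set_pmf_PA1\<close> and \<open>pmf_attach\<close>.\<close>

definition attach_pmf :: "nat multigraph \<Rightarrow> nat \<Rightarrow> nat pmf" where
  "attach_pmf G t = embed_pmf (\<lambda>s.
     if s \<in> {1..<t} then real (mdegree G s) / (2 * real t - 1)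
     else if s = t then 1 / (2 * real t - 1)
     else 0)"

fun PA1 :: "nat \<Rightarrow> nat multigraph pmf" where
  "PA1 0 = return_pmf ({}, {#})"
| "PA1 (Suc 0) = return_pmf ({1}, {#Upair 1 1#})"
| "PA1 (Suc (Suc k)) =
     (let t = Suc (Suc k) in
      do {
        G \<leftarrow> PA1 (Suc k);
        s \<leftarrow> attach_pmf G t;
        return_pmf (insert t (mverts G), add_mset (Upair t s) (medges G))
      })"

text \<open>Vertex \<open>i \<ge> 1\<close> lies in block \<open>(i - 1) div m + 1\<close>, i.e.\ in the block \<open>j\<close> with
  \<open>m * (j - 1) + 1 \<le> i \<le> m * j\<close>.\<close>

definition PA :: "nat \<Rightarrow> nat \<Rightarrow> nat multigraph pmf" where
  "PA m n = map_pmf (merge_vertices (\<lambda>i. (i - 1) div m + 1)) (PA1 (m * n))"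

lemma mdegree_handshake:
  assumes "finite V" "\<forall>e\<in>#E. set_uprod e \<subseteq> V"
  shows "(\<Sum>v\<in>V. mdegree (W, E) v) = 2 * size E"
  using assms(2)
proof (induction E)
  case empty
  then show ?case by (simp add: mdegree_def)
next
  case (add e E)
  obtain a b where e: "e = Upair a b" by (cases e)
  have ab: "a \<in> V" "b \<in> V" using add.prems e by auto
  have *: "(if Upair a b = Upair v v then 2 else if v \<in> set_uprod (Upair a b) then 1 else 0)
           = (if v = a then 1 else 0) + (if v = b then 1 else (0::nat))" for v
    by auto
  have "(\<Sum>v\<in>V. mdegree (W, add_mset e E) v) =
        (\<Sum>v\<in>V. (if v = a then 1 else 0) + (if v = b then 1 else 0) + mdegree (W, E) v)"
    unfolding mdegree_def e by (simp only: * snd_conv image_mset_add_mset sum_mset.add_mset)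
  also have "\<dots> = 2 + 2 * size E"
    using add ab assms(1) by (simp add: sum.distrib sum.delta)
  finally show ?case by simp
qed

lemma pmf_attach:
  assumes "t \<ge> 1" "size (medges G) = t - 1" "\<forall>e\<in>#medges G. set_uprod e \<subseteq> {1..<t}"
  shows "pmf (attach_pmf G t) s =
     (if s \<in> {1..<t} then real (mdegree G s) / (2 * real t - 1)
      else if s = t then 1 / (2 * real t - 1)
      else 0)"
proof -
  define f where "f s =
     (if s \<in> {1..<t} then real (mdegree G s) / (2 * real t - 1)
      else if s = t then 1 / (2 * real t - 1)
      else 0)" for s
  have pos: "f s \<ge> 0" for s using assms(1) by (simp add: f_def)
  have "(\<Sum>s\<in>{1..<t}. mdegree G s) = 2 * (t - 1)"
    using mdegree_handshake[of "{1..<t}" "medges G" "mverts G"] assms by simp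
  then have hs: "(\<Sum>s\<in>{1..<t}. real (mdegree G s)) = 2 * (real t - 1)"
    using assms(1) by (metis of_nat_1 of_nat_diff of_nat_mult of_nat_numeral of_nat_sum)
  have "{1..t} = insert t {1..<t}" using assms(1) by auto
  then have "(\<Sum>s\<in>{1..t}. f s) = f t + (\<Sum>s\<in>{1..<t}. f s)" by simp
  also have "(\<Sum>s\<in>{1..<t}. f s) = (\<Sum>s\<in>{1..<t}. real (mdegree G s)) / (2 * real t - 1)"
    unfolding sum_divide_distrib by (intro sum.cong) (auto simp: f_def)
  also have "f t + \<dots> = 1"
    unfolding hs using assms(1) by (simp add: f_def field_simps)
  finally have sum1: "(\<Sum>s\<in>{1..t}. f s) = 1" .
  have "(\<integral>\<^sup>+ s. ennreal (f s) \<partial>count_space UNIV) = (\<Sum>s\<in>{1..t}. ennreal (f s))"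
    by (rule nn_integral_count_space') (use assms(1) in \<open>auto simp: f_def\<close>)
  also have "\<dots> = 1" using sum1 pos by (simp add: sum_ennreal)
  finally have "pmf (embed_pmf f) s = f s" using pos by (intro pmf_embed_pmf) auto
  moreover have "attach_pmf G t = embed_pmf f" unfolding attach_pmf_def f_def ..
  ultimately show ?thesis by (simp add: f_def)
qed

lemma set_pmf_PA1:
  assumes "G \<in> set_pmf (PA1 t)"
  shows "mverts G = {1..t} \<and> size (medges G) = t \<and> (\<forall>e\<in>#medges G. set_uprod e \<subseteq> {1..t})"
  using assms
proof (induction t arbitrary: G rule: PA1.induct)
  case (3 k)
  then obtain H s where H: "H \<in> set_pmf (PA1 (Suc k))"
    and s: "s \<in> set_pmf (attach_pmf H (Suc (Suc k)))"
    and G: "G = (insert (Suc (Suc k)) (mverts H), add_mset (Upair (Suc (Suc k)) s) (medges H))"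
    by (auto simp: Let_def)
  have IH: "mverts H = {1..Suc k}" "size (medges H) = Suc k"
      "\<forall>e\<in>#medges H. set_uprod e \<subseteq> {1..Suc k}"
    using "3.IH"[OF refl H] by auto
  have "{1..<Suc (Suc k)} = {1..Suc k}" by auto
  then have "pmf (attach_pmf H (Suc (Suc k))) s = 0" if "s \<notin> {1..Suc (Suc k)}"
    using IH that by (subst pmf_attach) auto
  then have "s \<in> {1..Suc (Suc k)}" using s by (auto simp: set_pmf_iff)
  moreover have "{1..Suc (Suc k)} = insert (Suc (Suc k)) {1..Suc k}" by auto
  ultimately show ?case using IH unfolding G by auto
qed auto

end

theory Submission
  imports Defs "HOL-Real_Asymp.Real_Asymp"
begin

text \<open>If no edge of \<open>G_1^t\<close> crosses between a set \<open>T\<close> of vertices and its complement, then the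
  \<open>a\<close> vertices of \<open>T\<close> have total degree \<open>2a\<close>, because every vertex brings exactly one edge. A new
  vertex on the side of \<open>T\<close> therefore keeps \<open>T\<close> uncrossed with the deterministic probability
  \<open>(2a + 1) / (2t + 1)\<close>, and the probability that \<open>T\<close> is uncrossed in \<open>G_1^N\<close> is
  \<open>(1/2)_a (1/2)_b / (1/2)_N\<close> with \<open>b = N - a\<close> and rising factorials \<open>(x)_k\<close>. This is at most
  \<open>1 / (N choose a)\<close>. For the union of \<open>s\<close> out of \<open>n\<close> blocks of length \<open>m\<close> this gives
  \<open>1 / (mn choose ms) \<le> 1 / (n choose s)^m\<close>, so by a union bound over the sets of blocks
  \<open>G_m^n\<close> is disconnected with probability at most \<open>\<Sum>0<s<n. 1 / (n choose s)^(m-1) \<le> 4 / n^(m-1)\<close>.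
  This is far stronger than the claimed bound.\<close>

section \<open>Binomial coefficients and finite sums\<close>

lemma pochhammer_mult_binomial_le:
  fixes x :: "'a::linordered_field"
  assumes "0 \<le> x" "x \<le> 1"
  shows "pochhammer x a * pochhammer x b * of_nat ((a + b) choose a) \<le> pochhammer x (a + b)"
proof (induction a)
  case 0
  then show ?case by simp
next
  case (Suc a)
  have "Suc a * ((Suc a + b) choose Suc a) = Suc (a + b) * ((a + b) choose a)"
    using Suc_times_binomial[of a "a + b"] by (simp only: add_Suc)
  then have choose_Suc: "(of_nat (Suc a) :: 'a) * of_nat ((Suc a + b) choose Suc a) =
      of_nat (Suc (a + b)) * of_nat ((a + b) choose a)"
    by (simp only: flip: of_nat_mult)
  have factor_le: "(x + of_nat a) * of_nat (Suc (a + b)) \<le> of_nat (Suc a) * (x + of_nat (a + b))"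
    using mult_right_mono[OF assms(2), of "of_nat b"] by (simp add: algebra_simps)
  have "of_nat (Suc a) *
        (pochhammer x (Suc a) * pochhammer x b * of_nat ((Suc a + b) choose Suc a)) =
      (x + of_nat a) * pochhammer x a * pochhammer x b *
        (of_nat (Suc a) * of_nat ((Suc a + b) choose Suc a))"
    by (simp only: pochhammer_rec' ac_simps)
  also have "\<dots> = ((x + of_nat a) * of_nat (Suc (a + b))) *
      (pochhammer x a * pochhammer x b * of_nat ((a + b) choose a))"
    unfolding choose_Suc by (simp only: ac_simps)
  also have "\<dots> \<le> (of_nat (Suc a) * (x + of_nat (a + b))) * pochhammer x (a + b)"
    using assms(1)
    by (intro mult_mono factor_le Suc.IH) (simp_all add: pochhammer_prod prod_nonneg)
  also have "\<dots> = of_nat (Suc a) * pochhammer x (Suc a + b)"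
    by (simp only: add_Suc pochhammer_rec' mult.assoc)
  finally show ?case by (simp only: mult_le_cancel_left_pos of_nat_0_less_iff zero_less_Suc)
qed

lemma binomial_mult_le_binomial_add:
  "(a choose c) * (b choose d) \<le> (a + b) choose (c + d)"
proof -
  have "(a choose c) * (b choose d) = (\<Sum>k\<in>{c}. (a choose k) * (b choose (c + d - k)))" by simp
  also have "\<dots> \<le> (\<Sum>k\<le>c + d. (a choose k) * (b choose (c + d - k)))"
    by (intro sum_mono2) auto
  finally show ?thesis by (simp add: vandermonde)
qed

lemma binomial_power_le: "(n choose s) ^ m \<le> (m * n) choose (m * s)"
proof (induction m)
  case 0
  then show ?case by simp
next
  case (Suc m)
  have "(n choose s) ^ Suc m \<le> (n choose s) * ((m * n) choose (m * s))"
    using Suc.IH by simp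
  also have "\<dots> \<le> (n + m * n) choose (s + m * s)" by (rule binomial_mult_le_binomial_add)
  finally show ?case by simp
qed

lemma binomial_le_binomial_inner:
  assumes "j \<le> s" "s + j \<le> n"
  shows "n choose j \<le> n choose s"
proof (cases "2 * s \<le> n")
  case True
  then show ?thesis using assms(1) by (rule binomial_mono[rotated])
next
  case False
  have "n choose j = n choose (n - j)" using assms by (intro binomial_symmetric) simp
  also have "\<dots> \<le> n choose s" using False assms by (intro binomial_antimono) auto
  finally show ?thesis .
qed

lemma sum_inverse_binomial_le: "(\<Sum>s\<in>{0<..<n}. 1 / real (n choose s)) \<le> 4 / real n"
proof (cases "n \<ge> 2")
  case False
  then have "{0<..<n} = {}" by auto
  then show ?thesis by simp
next
  case True
  let ?inner = "2 / (real n * (real n - 1))"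
  have choose_two_real: "real (n choose 2) = real n * (real n - 1) / 2"
    using True by (simp add: choose_two real_of_nat_div of_nat_diff)
  have term_le: "1 / real (n choose s) \<le>
      ?inner + (if s = 1 then 1 / real n else 0) + (if s = n - 1 then 1 / real n else 0)"
    if s: "s \<in> {0<..<n}" for s
  proof (cases "s = 1 \<or> s = n - 1")
    case True
    then have "n choose s = n" using s binomial_symmetric[of 1 n] by auto
    then show ?thesis using True \<open>n \<ge> 2\<close> by auto
  next
    case False
    then have "real (n choose 2) \<le> real (n choose s)"
      using s by (intro of_nat_mono binomial_le_binomial_inner) auto
    then have "1 / real (n choose s) \<le> 1 / real (n choose 2)"
      using \<open>n \<ge> 2\<close> s by (intro divide_left_mono mult_pos_pos) auto
    then show ?thesis using False by (simp add: choose_two_real)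
  qed
  have "(\<Sum>s\<in>{0<..<n}. 1 / real (n choose s)) \<le> (\<Sum>s\<in>{0<..<n}.
      ?inner + (if s = 1 then 1 / real n else 0) + (if s = n - 1 then 1 / real n else 0))"
    using term_le by (rule sum_mono)
  also have "\<dots> = (real n - 1) * ?inner + 1 / real n + 1 / real n"
    using True by (simp add: sum.distrib sum.delta of_nat_diff)
  also have "\<dots> = 4 / real n" using True by (simp add: field_simps)
  finally show ?thesis .
qed

lemma sum_inverse_binomial_power_le:
  assumes "k > 0"
  shows "(\<Sum>s\<in>{0<..<n}. 1 / real (n choose s) ^ k) \<le> 4 / real n ^ k"
proof -
  obtain l where k: "k = Suc l" using assms by (cases k) auto
  have "1 / real (n choose s) ^ k \<le> 1 / real n ^ l * (1 / real (n choose s))"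
    if s: "s \<in> {0<..<n}" for s
  proof -
    have "n \<le> n choose s" using binomial_le_binomial_inner[of 1 s n] s by simp
    then have "real n ^ l * real (n choose s) \<le> real (n choose s) ^ k"
      unfolding k power_Suc2 by (intro mult_right_mono power_mono) auto
    then show ?thesis using s by (simp add: frac_le)
  qed
  then have "(\<Sum>s\<in>{0<..<n}. 1 / real (n choose s) ^ k) \<le>
      1 / real n ^ l * (\<Sum>s\<in>{0<..<n}. 1 / real (n choose s))"
    unfolding sum_distrib_left by (rule sum_mono)
  also have "\<dots> \<le> 1 / real n ^ l * (4 / real n)"
    by (intro mult_left_mono sum_inverse_binomial_le) simp
  finally show ?thesis by (simp add: k mult.commute)
qed

lemma sum_psubsets_card:
  fixes g :: "nat \<Rightarrow> 'a::semiring_1"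
  assumes "finite A"
  shows "(\<Sum>S | S \<subset> A \<and> S \<noteq> {}. g (card S)) =
    (\<Sum>s\<in>{0<..<card A}. of_nat (card A choose s) * g s)"
proof -
  let ?P = "{S. S \<subset> A \<and> S \<noteq> {}}"
  have fin: "finite ?P" using assms by (intro finite_subset[of ?P "Pow A"]) auto
  have "card ` ?P \<subseteq> {0<..<card A}"
    using assms by (auto simp: card_gt_0_iff intro: psubset_card_mono dest: finite_subset[of _ A])
  then have "(\<Sum>S\<in>?P. g (card S)) = (\<Sum>s\<in>{0<..<card A}. \<Sum>S | S \<in> ?P \<and> card S = s. g (card S))"
    using fin by (intro sum.group[symmetric]) auto
  also have "\<dots> = (\<Sum>s\<in>{0<..<card A}. of_nat (card A choose s) * g s)"
  proof (intro sum.cong refl)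
    fix s assume "s \<in> {0<..<card A}"
    then have "{S. S \<in> ?P \<and> card S = s} = {S. S \<subseteq> A \<and> card S = s}" by auto
    then show "(\<Sum>S | S \<in> ?P \<and> card S = s. g (card S)) = of_nat (card A choose s) * g s"
      using n_subsets[OF assms, of s] by simp
  qed
  finally show ?thesis .
qed

lemma sum_Int_atLeastAtMost_Suc:
  fixes f :: "nat \<Rightarrow> 'a::semiring_1"
  shows "(\<Sum>v\<in>T \<inter> {1..Suc t}. f v) = (\<Sum>v\<in>T \<inter> {1..t}. f v) + of_bool (Suc t \<in> T) * f (Suc t)"
  by (simp add: atLeastAtMostSuc_conv Int_insert_right add.commute)

lemma card_Int_atLeastAtMost_Suc:
  "card (T \<inter> {1..Suc t}) = card (T \<inter> {1..t}) + of_bool (Suc t \<in> T)"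
  by (simp add: atLeastAtMostSuc_conv Int_insert_right)

section \<open>Uncrossed vertex sets\<close>

definition uncrossed :: "'a set \<Rightarrow> 'a multigraph \<Rightarrow> bool" where
  "uncrossed T G \<longleftrightarrow> (\<forall>e\<in>#medges G. set_uprod e \<subseteq> T \<or> set_uprod e \<inter> T = {})"

definition attach_vertex :: "'a \<Rightarrow> 'a \<Rightarrow> 'a multigraph \<Rightarrow> 'a multigraph" where
  "attach_vertex t s G = (insert t (mverts G), add_mset (Upair t s) (medges G))"

lemma uncrossed_Compl: "uncrossed (- T) G \<longleftrightarrow> uncrossed T G"
  unfolding uncrossed_def by blast

lemma uncrossed_attach_vertex:
  "uncrossed T (attach_vertex t s G) \<longleftrightarrow> (s \<in> T \<longleftrightarrow> t \<in> T) \<and> uncrossed T G"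
  unfolding uncrossed_def attach_vertex_def by auto

lemma uncrossed_merge_vertices:
  "uncrossed S (merge_vertices f G) \<longleftrightarrow> uncrossed (f -` S) G"
  unfolding uncrossed_def merge_vertices_def by (fastforce simp: uprod.set_map)

lemma not_mconnected_obtains_uncrossed:
  assumes "\<not> mconnected G" "\<forall>e\<in>#medges G. set_uprod e \<subseteq> mverts G"
  obtains S where "S \<subset> mverts G" "S \<noteq> {}" "uncrossed S G"
proof -
  define adj where "adj x y \<longleftrightarrow> Upair x y \<in># medges G" for x y
  obtain u v where uv: "u \<in> mverts G" "v \<in> mverts G" "\<not> adj\<^sup>*\<^sup>* u v"
    using assms(1) unfolding mconnected_def adj_def[abs_def] by blast
  define S where "S = {w \<in> mverts G. adj\<^sup>*\<^sup>* u w}"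
  have "uncrossed S G"
    unfolding uncrossed_def
  proof
    fix e assume e: "e \<in># medges G"
    obtain a b where ab: "e = Upair a b" by (cases e)
    have "Upair b a = Upair a b" by (simp add: Upair_inject)
    then have "adj a b" "adj b a" using e unfolding adj_def ab by metis+
    moreover have "a \<in> mverts G" "b \<in> mverts G" using assms(2) e ab by auto
    ultimately have "a \<in> S \<longleftrightarrow> b \<in> S"
      unfolding S_def by (auto intro: rtranclp.rtrancl_into_rtrancl)
    then show "set_uprod e \<subseteq> S \<or> set_uprod e \<inter> S = {}" unfolding ab by auto
  qed
  moreover have "u \<in> S" "S \<subset> mverts G" using uv by (auto simp: S_def)
  ultimately show thesis using that by blast
qed

lemma mdegree_attach_vertex:
  "mdegree (attach_vertex t s G) v = mdegree G v + of_bool (v = t) + of_bool (v = s)"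
  by (auto simp: mdegree_def attach_vertex_def)

lemma mdegree_eq_0:
  assumes "\<forall>e\<in>#medges G. v \<notin> set_uprod e"
  shows "mdegree G v = 0"
  unfolding mdegree_def using assms by (subst sum_mset.neutral) auto

lemma sum_mdegree_attach_vertex:
  assumes "finite A"
  shows "(\<Sum>v\<in>A. mdegree (attach_vertex t s G) v) =
    (\<Sum>v\<in>A. mdegree G v) + of_bool (t \<in> A) + of_bool (s \<in> A)"
  using assms by (simp add: mdegree_attach_vertex sum.distrib of_bool_def sum.delta)

section \<open>One edge per vertex\<close>

lemma prob_bind_pmf_eq_mult:
  assumes "\<And>x. x \<in> set_pmf M \<Longrightarrow> measure_pmf.prob (f x) A = c * indicator B x"
  shows "measure_pmf.prob (bind_pmf M f) A = c * measure_pmf.prob M B"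
proof -
  have "measure_pmf.prob (bind_pmf M f) A = (\<integral>x. measure_pmf.prob (f x) A \<partial>M)"
    unfolding measure_pmf_bind
    by (rule measure_pmf.measure_bind[where N = "count_space UNIV"])
      (simp_all add: space_subprob_algebra measure_pmf.subprob_space_axioms)
  also have "\<dots> = (\<integral>x. c * indicator B x \<partial>M)"
    using assms by (intro integral_cong_AE) (simp_all add: AE_measure_pmf_iff)
  finally show ?thesis by simp
qed

lemma PA1_Suc:
  "PA1 (Suc t) =
    bind_pmf (PA1 t) (\<lambda>G. map_pmf (\<lambda>s. attach_vertex (Suc t) s G) (attach_pmf G (Suc t)))"
proof (cases t)
  case 0
  have "attach_pmf ({}, {#}) 1 = return_pmf (1 :: nat)"
    by (rule pmf_eqI) (simp add: pmf_attach indicator_def)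
  then show ?thesis using 0 by (simp add: bind_return_pmf attach_vertex_def)
next
  case (Suc k)
  then show ?thesis by (simp add: Let_def map_pmf_def attach_vertex_def)
qed

lemma mdegree_PA1_eq_0:
  assumes "G \<in> set_pmf (PA1 t)" "v \<notin> {1..t}"
  shows "mdegree G v = 0"
  using set_pmf_PA1[OF assms(1)] assms(2) by (intro mdegree_eq_0) blast

lemma pmf_attach_PA1:
  assumes "G \<in> set_pmf (PA1 t)"
  shows "pmf (attach_pmf G (Suc t)) s =
    (real (mdegree G s) + of_bool (s = Suc t)) / (2 * real t + 1)"
proof -
  have "{1..<Suc t} = {1..t}" by auto
  moreover have "s \<notin> {1..t} \<Longrightarrow> mdegree G s = 0" by (rule mdegree_PA1_eq_0[OF assms])
  ultimately show ?thesis using set_pmf_PA1[OF assms] by (subst pmf_attach) auto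
qed

lemma set_pmf_attach_PA1:
  assumes "G \<in> set_pmf (PA1 t)"
  shows "set_pmf (attach_pmf G (Suc t)) \<subseteq> {1..Suc t}"
proof
  fix s assume "s \<in> set_pmf (attach_pmf G (Suc t))"
  then have "mdegree G s \<noteq> 0 \<or> s = Suc t"
    by (auto simp: set_pmf_iff pmf_attach_PA1[OF assms])
  then show "s \<in> {1..Suc t}"
    using mdegree_PA1_eq_0[OF assms, of s] by fastforce
qed

lemma prob_attach_PA1:
  assumes "G \<in> set_pmf (PA1 t)"
  shows "measure_pmf.prob (attach_pmf G (Suc t)) T =
    (real (\<Sum>v\<in>T \<inter> {1..t}. mdegree G v) + of_bool (Suc t \<in> T)) / (2 * real t + 1)"
proof -
  have "measure_pmf.prob (attach_pmf G (Suc t)) T =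
      measure_pmf.prob (attach_pmf G (Suc t)) (T \<inter> {1..Suc t})"
    using set_pmf_attach_PA1[OF assms]
    by (intro measure_pmf.finite_measure_eq_AE) (auto simp: AE_measure_pmf_iff)
  also have "\<dots> = (\<Sum>s\<in>T \<inter> {1..Suc t}. pmf (attach_pmf G (Suc t)) s)"
    by (simp add: measure_measure_pmf_finite)
  also have "\<dots> = (\<Sum>s\<in>T \<inter> {1..Suc t}. real (mdegree G s) + of_bool (s = Suc t)) /
      (2 * real t + 1)"
    by (simp only: pmf_attach_PA1[OF assms] sum_divide_distrib)
  also have "mdegree G (Suc t) = 0" by (rule mdegree_PA1_eq_0[OF assms]) simp
  then have "(\<Sum>s\<in>T \<inter> {1..Suc t}. real (mdegree G s) + of_bool (s = Suc t)) =
      real (\<Sum>v\<in>T \<inter> {1..t}. mdegree G v) + of_bool (Suc t \<in> T)"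
    unfolding sum_Int_atLeastAtMost_Suc by (simp add: sum.neutral)
  finally show ?thesis .
qed

lemma sum_mdegree_uncrossed_PA1:
  assumes "G \<in> set_pmf (PA1 t)" "uncrossed T G"
  shows "(\<Sum>v\<in>T \<inter> {1..t}. mdegree G v) = 2 * card (T \<inter> {1..t})"
  using assms
proof (induction t arbitrary: G)
  case 0
  then show ?case by simp
next
  case (Suc t)
  obtain H s where H: "H \<in> set_pmf (PA1 t)" and s: "s \<in> set_pmf (attach_pmf H (Suc t))"
    and G: "G = attach_vertex (Suc t) s H"
    using Suc.prems(1) unfolding PA1_Suc by auto
  have "s \<in> T \<longleftrightarrow> Suc t \<in> T" and "uncrossed T H"
    using Suc.prems(2) unfolding G uncrossed_attach_vertex by auto
  moreover have "s \<in> {1..Suc t}" using set_pmf_attach_PA1[OF H] s by blast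
  ultimately have "(\<Sum>v\<in>T \<inter> {1..Suc t}. mdegree G v) =
      (\<Sum>v\<in>T \<inter> {1..Suc t}. mdegree H v) + 2 * of_bool (Suc t \<in> T)"
    unfolding G by (simp add: sum_mdegree_attach_vertex)
  also have "mdegree H (Suc t) = 0" by (rule mdegree_PA1_eq_0[OF H]) simp
  then have "(\<Sum>v\<in>T \<inter> {1..Suc t}. mdegree H v) = (\<Sum>v\<in>T \<inter> {1..t}. mdegree H v)"
    unfolding sum_Int_atLeastAtMost_Suc by simp
  also have "\<dots> = 2 * card (T \<inter> {1..t})" by (rule Suc.IH[OF H \<open>uncrossed T H\<close>])
  finally show ?case unfolding card_Int_atLeastAtMost_Suc by simp
qed

lemma prob_PA1_Suc_uncrossed:
  assumes "Suc t \<in> T"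
  shows "measure_pmf.prob (PA1 (Suc t)) {G. uncrossed T G} =
    (1 / 2 + real (card (T \<inter> {1..t}))) / (1 / 2 + real t) *
      measure_pmf.prob (PA1 t) {G. uncrossed T G}"
  unfolding PA1_Suc
proof (rule prob_bind_pmf_eq_mult)
  fix G assume G: "G \<in> set_pmf (PA1 t)"
  have "(\<lambda>s. attach_vertex (Suc t) s G) -` {G. uncrossed T G} = (if uncrossed T G then T else {})"
    using assms by (auto simp: uncrossed_attach_vertex)
  then show "measure_pmf.prob (map_pmf (\<lambda>s. attach_vertex (Suc t) s G) (attach_pmf G (Suc t)))
      {G. uncrossed T G} =
    (1 / 2 + real (card (T \<inter> {1..t}))) / (1 / 2 + real t) * indicator {G. uncrossed T G} G"
    using assms sum_mdegree_uncrossed_PA1[OF G, of T]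
    by (simp add: prob_attach_PA1[OF G] field_simps del: of_nat_sum)
qed

lemma prob_PA1_uncrossed:
  "measure_pmf.prob (PA1 t) {G. uncrossed T G} =
    pochhammer (1 / 2) (card (T \<inter> {1..t})) * pochhammer (1 / 2) (card (- T \<inter> {1..t})) /
      pochhammer (1 / 2) t"
    (is "?P t T")
proof (induction t arbitrary: T)
  case 0
  then show ?case by (simp add: uncrossed_def)
next
  case (Suc t)
  have new_in: "?P (Suc t) T" if "Suc t \<in> T" for T
    unfolding prob_PA1_Suc_uncrossed[OF that] Suc.IH card_Int_atLeastAtMost_Suc
    using that by (simp add: pochhammer_rec')
  show ?case
  proof (cases "Suc t \<in> T")
    case True
    then show ?thesis by (rule new_in)
  next
    case False
    then show ?thesis using new_in[of "- T"] by (simp add: uncrossed_Compl mult.commute)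
  qed
qed

lemma prob_PA1_uncrossed_le:
  "measure_pmf.prob (PA1 t) {G. uncrossed T G} \<le> 1 / real (t choose card (T \<inter> {1..t}))"
proof -
  define a b where "a = card (T \<inter> {1..t})" and "b = card (- T \<inter> {1..t})"
  have "a + b = card (T \<inter> {1..t} \<union> - T \<inter> {1..t})"
    unfolding a_def b_def by (subst card_Un_disjoint) auto
  also have "T \<inter> {1..t} \<union> - T \<inter> {1..t} = {1..t}" by auto
  finally have t: "t = a + b" by simp
  have "pochhammer (1 / 2) a * pochhammer (1 / 2) b * real (t choose a) \<le> pochhammer (1 / 2) t"
    unfolding t by (rule pochhammer_mult_binomial_le) simp_all
  then have "pochhammer (1 / 2) a * pochhammer (1 / 2) b / pochhammer (1 / 2) t \<le>
      1 / real (t choose a)"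
    using pochhammer_pos[of "1 / 2 :: real" t] by (simp add: t field_simps)
  then show ?thesis unfolding prob_PA1_uncrossed a_def b_def .
qed

section \<open>Merged blocks\<close>

definition block :: "nat \<Rightarrow> nat \<Rightarrow> nat" where
  "block m i = (i - 1) div m + 1"

lemma card_vimage_block:
  assumes "m > 0" "S \<subseteq> {1..n}"
  shows "card (block m -` S \<inter> {1..m * n}) = m * card S"
proof -
  have "bij_betw (\<lambda>i. (block m i, (i - 1) mod m)) (block m -` S \<inter> {1..m * n}) (S \<times> {..<m})"
  proof (rule bij_betw_byWitness[where f' = "\<lambda>(j, r). m * (j - 1) + r + 1"])
    show "\<forall>p\<in>S \<times> {..<m}. (\<lambda>i. (block m i, (i - 1) mod m)) ((\<lambda>(j, r). m * (j - 1) + r + 1) p) = p"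
      using assms by (auto simp: block_def)
    show "(\<lambda>(j, r). m * (j - 1) + r + 1) ` (S \<times> {..<m}) \<subseteq> block m -` S \<inter> {1..m * n}"
    proof clarify
      fix j r assume "j \<in> S" "r < m"
      moreover from \<open>j \<in> S\<close> assms(2) obtain l where "j = Suc l" "l < n" by (cases j) auto
      moreover have "m * l + m \<le> m * n"
        using \<open>l < n\<close> mult_le_mono2[of "Suc l" n m] by simp
      ultimately show "m * (j - 1) + r + 1 \<in> block m -` S \<inter> {1..m * n}"
        by (simp add: block_def)
    qed
  qed (use assms in \<open>auto simp: block_def\<close>)
  then show ?thesis by (simp add: bij_betw_same_card card_cartesian_product mult.commute)
qed

lemma block_image_subset:
  assumes "m > 0"
  shows "block m ` {1..m * n} \<subseteq> {1..n}"
proof safe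
  fix i assume "i \<in> {1..m * n}"
  then have "(i - 1) div m < n"
    using assms by (subst div_less_iff_less_mult) (auto simp: mult.commute)
  then show "block m i \<in> {1..n}" by (simp add: block_def)
qed

lemma PA_eq_map_block: "PA m n = map_pmf (merge_vertices (block m)) (PA1 (m * n))"
  by (simp add: PA_def block_def[abs_def])

lemma set_pmf_PA:
  assumes "m > 0" "G \<in> set_pmf (PA m n)"
  shows "mverts G \<subseteq> {1..n}" "\<forall>e\<in>#medges G. set_uprod e \<subseteq> mverts G"
proof -
  obtain H where H: "H \<in> set_pmf (PA1 (m * n))" and G: "G = merge_vertices (block m) H"
    using assms(2) by (auto simp: PA_eq_map_block)
  show "mverts G \<subseteq> {1..n}"
    using set_pmf_PA1[OF H] block_image_subset[OF assms(1)] by (simp add: G merge_vertices_def)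
  show "\<forall>e\<in>#medges G. set_uprod e \<subseteq> mverts G"
    using set_pmf_PA1[OF H] by (auto simp: G merge_vertices_def uprod.set_map)
qed

lemma prob_PA_uncrossed_le:
  assumes "m > 0" "S \<subseteq> {1..n}"
  shows "measure_pmf.prob (PA m n) {G. uncrossed S G} \<le> 1 / real (n choose card S) ^ m"
proof -
  have "measure_pmf.prob (PA m n) {G. uncrossed S G} =
      measure_pmf.prob (PA1 (m * n)) {G. uncrossed (block m -` S) G}"
    by (simp add: PA_eq_map_block vimage_def uncrossed_merge_vertices)
  also have "\<dots> \<le> 1 / real ((m * n) choose (m * card S))"
    using prob_PA1_uncrossed_le[of "m * n" "block m -` S"] card_vimage_block[OF assms] by simp
  also have "\<dots> \<le> 1 / real ((n choose card S) ^ m)"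
  proof -
    have "card S \<le> n" using card_mono[OF _ assms(2)] by simp
    then show ?thesis by (intro divide_left_mono of_nat_mono binomial_power_le) auto
  qed
  finally show ?thesis by simp
qed

lemma prob_PA_not_mconnected_le_sum:
  assumes "m > 0"
  shows "measure_pmf.prob (PA m n) {G. \<not> mconnected G} \<le>
    (\<Sum>s\<in>{0<..<n}. 1 / real (n choose s) ^ (m - 1))"
proof -
  let ?P = "{S. S \<subset> {1..n} \<and> S \<noteq> {}}"
  have fin: "finite ?P" by (rule finite_subset[of _ "Pow {1..n}"]) auto
  have "AE G in PA m n. \<not> mconnected G \<longrightarrow> G \<in> (\<Union>S\<in>?P. {G. uncrossed S G})"
    unfolding AE_measure_pmf_iff
  proof (intro ballI impI)
    fix G assume G: "G \<in> set_pmf (PA m n)" and "\<not> mconnected G"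
    then obtain S where "S \<subset> mverts G" "S \<noteq> {}" "uncrossed S G"
      using not_mconnected_obtains_uncrossed set_pmf_PA(2)[OF assms] by metis
    moreover have "mverts G \<subseteq> {1..n}" by (rule set_pmf_PA(1)[OF assms G])
    ultimately show "G \<in> (\<Union>S\<in>?P. {G. uncrossed S G})" by blast
  qed
  then have "measure_pmf.prob (PA m n) {G. \<not> mconnected G} \<le>
      measure_pmf.prob (PA m n) (\<Union>S\<in>?P. {G. uncrossed S G})"
    by (intro measure_pmf.finite_measure_mono_AE) simp_all
  also have "\<dots> \<le> (\<Sum>S\<in>?P. measure_pmf.prob (PA m n) {G. uncrossed S G})"
    using fin by (intro measure_UNION_le) auto
  also have "\<dots> \<le> (\<Sum>S\<in>?P. 1 / real (n choose card S) ^ m)"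
    using assms by (intro sum_mono prob_PA_uncrossed_le) auto
  also have "\<dots> = (\<Sum>s\<in>{0<..<n}. real (n choose s) * (1 / real (n choose s) ^ m))"
    using sum_psubsets_card[of "{1..n}" "\<lambda>s. 1 / real (n choose s) ^ m"] by simp
  also have "\<dots> = (\<Sum>s\<in>{0<..<n}. 1 / real (n choose s) ^ (m - 1))"
    using assms by (intro sum.cong) (auto simp: power_eq_if)
  finally show ?thesis .
qed

lemma prob_PA_not_mconnected_le:
  assumes "m > 1"
  shows "measure_pmf.prob (PA m n) {G. \<not> mconnected G} \<le> 4 / real n ^ (m - 1)"
  using prob_PA_not_mconnected_le_sum[of m n] sum_inverse_binomial_power_le[of "m - 1" n] assms
  by simp

theorem theorem4p3:
  fixes m :: nat and \<epsilon> :: real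
  assumes "m > 1" and "\<epsilon> > 0"
  shows "(\<lambda>n. 1 - measure_pmf.prob (PA m n) {G. mconnected G})
           \<in> O(\<lambda>n. (ln (ln (real n)) powr (1 + \<epsilon>) / ln (real n)) powr ((real m - 1) / 3))"
proof -
  have "1 - measure_pmf.prob (PA m n) {G. mconnected G} =
      measure_pmf.prob (PA m n) {G. \<not> mconnected G}" for n
    using measure_pmf.prob_compl[of "{G. mconnected G}" "PA m n"]
    by (simp add: Compl_eq set_diff_eq)
  then have "(\<lambda>n. 1 - measure_pmf.prob (PA m n) {G. mconnected G}) \<in> O(\<lambda>n. 4 / real n ^ (m - 1))"
    using prob_PA_not_mconnected_le[OF assms(1)] by (intro landau_o.big_mono always_eventually) simp
  also have "(\<lambda>n. 4 / real n ^ (m - 1)) \<in>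
      O(\<lambda>n. (ln (ln (real n)) powr (1 + \<epsilon>) / ln (real n)) powr ((real m - 1) / 3))"
    using assms by real_asymp
  finally show ?thesis .
qed

end
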